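(* Let $p$ be a prime and let $s$ be a nonnegative integer such that $p\equiv 1\pmod 3$ and $s\leq (p-4)/6$. Then $$\sum_{k=s}^{(2p+1)/3+s}(6k-1)\frac{(-\frac{1}{3})_{k-s}(-\frac{1}{3})_{k+s}(-\frac{1}{3})_{k}}{(k-s)!\,(k+s)!\,k!}\equiv 0\pmod{p^3}.$$
   Context: For a nonnegative integer $m$, the shifted factorial is $(x)_0=1$ and $(x)_m=x(x+1)\cdots(x+m-1)$ for $m\ge 1$. The congruence is between rational numbers that are $p$-adic integers: $A\equiv 0\pmod{p^3}$ means $A\in p^3\mathbb{Z}_p$, where $\mathbb{Z}_p$ is the ring of $p$-adic integers. *)

theory Defs
  imports "HOL-Number_Theory.Number_Theory"
begin

text \<open>
  The ring of \<open>p\<close>-adic integers is not in the library.  The congruence only concerns rational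
  numbers \<open>A\<close>, and \<open>A = p ^ n * z\<close> with \<open>z\<close> in \<open>\<int>\<^sub>p\<close> forces \<open>z\<close> to be rational.  Hence only
  \<open>\<rat> \<inter> \<int>\<^sub>p\<close>, the rationals of \<open>p\<close>-adic absolute value at most 1, is defined here.
\<close>

definition padic_val :: "nat \<Rightarrow> rat \<Rightarrow> int" where
  "padic_val p x =
     int (multiplicity (int p) (fst (quotient_of x))) -
     int (multiplicity (int p) (snd (quotient_of x)))"

definition padic_abs :: "nat \<Rightarrow> rat \<Rightarrow> real" where
  "padic_abs p x = (if x = 0 then 0 else real p powi (- padic_val p x))"

definition padic_ints :: "nat \<Rightarrow> rat set" where
  "padic_ints p = {x. padic_abs p x \<le> 1}"

text \<open>The set \<open>p ^ n \<int>\<^sub>p\<close>, restricted to rational numbers.\<close>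

definition padic_multiples :: "nat \<Rightarrow> nat \<Rightarrow> rat set" where
  "padic_multiples p n = {of_nat p ^ n * z | z. z \<in> padic_ints p}"

lemma padic_ints_iff_denominator:
  assumes p: "prime p"
  shows "x \<in> padic_ints p \<longleftrightarrow> \<not> int p dvd snd (quotient_of x)"
proof (cases "x = 0")
  case True
  with p show ?thesis
    by (auto simp: padic_ints_def padic_abs_def dest: prime_gt_1_nat)
next
  case False
  obtain a b where ab: "quotient_of x = (a, b)" by fastforce
  have b: "b > 0" and cop: "coprime a b" and x: "x = of_int a / of_int b"
    using ab quotient_of_denom_pos quotient_of_coprime quotient_of_div by auto
  have a: "a \<noteq> 0" using False x by auto
  have P: "prime (int p)" and p1: "real p > 1"
    using p prime_gt_1_nat by auto
  have val: "padic_val p x = int (multiplicity (int p) a) - int (multiplicity (int p) b)"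
    by (simp add: padic_val_def ab)
  have pos: "multiplicity (int p) c > 0 \<longleftrightarrow> int p dvd c" if "c \<noteq> 0" for c
    using that P by (simp add: prime_multiplicity_gt_zero_iff)
  have "x \<in> padic_ints p \<longleftrightarrow> real p powi (- padic_val p x) \<le> real p powi 0"
    using False by (simp add: padic_ints_def padic_abs_def)
  also have "\<dots> \<longleftrightarrow> padic_val p x \<ge> 0"
    using p1 power_int_strict_increasing[of 0 "- padic_val p x" "real p"]
      power_int_increasing[of "- padic_val p x" 0 "real p"] by force
  also have "\<dots> \<longleftrightarrow> \<not> int p dvd b"
  proof (cases "int p dvd b")
    case True
    then have "\<not> int p dvd a"
      using cop P by (meson coprime_common_divisor not_prime_unit)
    with True pos[of a] pos[of b] a b show ?thesis by (auto simp: val)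
  next
    case False
    with pos[of b] b show ?thesis by (auto simp: val)
  qed
  finally show ?thesis by (simp add: ab)
qed

end

theory Submission
  imports Defs
begin

text \<open>
  The series is a very-well-poised one whose partial sums have a closed form: for every \<open>N \<ge> s\<close>,
  the sum over \<open>s \<le> k \<le> N\<close> equals \<open>27 (3 N + 1) / (1 - 9 s\<^sup>2)\<close> times the product of
  \<open>(-1/3)\<^bsub>m + 1\<^esub> / m!\<close> over \<open>m = N - s, N, N + s\<close>.
  For \<open>N = (2 p + 1) / 3 + s\<close> each of the three shifted factorials contains the
  factor \<open>2 p / 3\<close>, while no denominator is divisible by \<open>p\<close> because \<open>N + s < p\<close>.
\<close>

text \<open>The fraction need not be reduced: by coprimality the reduced denominator divides
  \<open>b\<close>, so \<open>p\<close> does not divide it either.\<close>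

lemma padic_intsI:
  assumes p: "prime p" and eq: "x = of_int a / of_int b" and b: "\<not> int p dvd b"
  shows "x \<in> padic_ints p"
proof -
  obtain c d where cd: "quotient_of x = (c, d)" by fastforce
  have d: "d > 0" and cop: "coprime c d" and x: "x = of_int c / of_int d"
    using cd quotient_of_denom_pos quotient_of_coprime quotient_of_div by auto
  have "b \<noteq> 0" using b by auto
  then have "(of_int (a * d) :: rat) = of_int (c * b)"
    using eq x d by (simp add: field_simps)
  then have "a * d = c * b" by (simp only: of_int_eq_iff)
  then have "d dvd c * b" by (metis dvd_triv_right)
  then have "d dvd b" using cop by (simp add: coprime_commute coprime_dvd_mult_right_iff)
  with b have "\<not> int p dvd d" using dvd_trans by blast
  then show ?thesis by (simp add: padic_ints_iff_denominator[OF p] cd)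
qed

lemma padic_multiplesI:
  assumes p: "prime p" and eq: "x = of_int (int p ^ n * a) / of_int b" and b: "\<not> int p dvd b"
  shows "x \<in> padic_multiples p n"
proof -
  have "x = of_nat p ^ n * (of_int a / of_int b)" by (simp add: eq)
  then show ?thesis
    using padic_intsI[OF p refl b] unfolding padic_multiples_def by blast
qed

text \<open>Since -1/3 + j = (3 j - 1) / 3, divisibility by \<open>p\<close> can be read off an
  integer product.\<close>

lemma pochhammer_minus_third:
  "pochhammer (- 1 / 3 :: rat) m = of_int (\<Prod>j<m. 3 * int j - 1) / of_int (3 ^ m)"
  by (induction m) (simp_all add: pochhammer_Suc field_simps)

lemma square_ne_ninth: "1 - 9 * (of_nat s :: rat)\<^sup>2 \<noteq> 0"
proof
  assume "1 - 9 * (of_nat s :: rat)\<^sup>2 = 0"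
  then have "(of_int (9 * (int s)\<^sup>2) :: rat) = of_int 1" by simp
  then have "9 * (int s)\<^sup>2 = 1" by (simp only: of_int_eq_iff)
  then show False by presburger
qed

text \<open>Induction on j = N - s. With upper limit \<open>j + s\<close>, the closed form contains
  no truncated subtraction.\<close>

lemma sum_very_well_poised_third:
  "(\<Sum>k = s..j + s. (6 * of_nat k - 1) *
      (pochhammer (- 1 / 3) (k - s) * pochhammer (- 1 / 3) (k + s) * pochhammer (- 1 / 3) k) /
      (fact (k - s) * fact (k + s) * fact k) :: rat) =
   27 * (3 * of_nat (j + s) + 1) / (1 - 9 * (of_nat s)\<^sup>2) *
     (pochhammer (- 1 / 3) (j + 1) * pochhammer (- 1 / 3) (j + 2 * s + 1)
        * pochhammer (- 1 / 3) (j + s + 1)) /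
     (fact j * fact (j + 2 * s) * fact (j + s))"
proof (induction j)
  case 0
  define c :: rat where "c = 1 - 9 * (of_nat s)\<^sup>2"
  have c: "c \<noteq> 0" using square_ne_ninth[of s] by (simp add: c_def)
  \<comment> \<open>What remains of the single-term case once the common shifted factorials and
    factorials cancel; -9 is 27 times the factor -1/3 of
    \<open>pochhammer (- 1 / 3) 1\<close>.\<close>
  have "(6 * of_nat s - 1) * c =
      - 9 * (3 * of_nat s + 1) * ((2 * of_nat s - 1 / 3) * (of_nat s - 1 / 3))"
    by (simp add: c_def algebra_simps power2_eq_square)
  then have "6 * of_nat s - 1 =
      - 9 * (3 * of_nat s + 1) * ((2 * of_nat s - 1 / 3) * (of_nat s - 1 / 3)) / c"
    by (simp only: nonzero_eq_divide_eq[OF c])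
  then show ?case
    unfolding c_def[symmetric]
    by (simp add: pochhammer_Suc flip: mult_2) (simp add: divide_simps c, simp add: algebra_simps)
next
  case (Suc j)
  \<comment> \<open>\<open>X\<close> is the closed form at \<open>j\<close> without its rational
    prefactor, and \<open>D\<close> collects the new factors of the three factorials. The next
    summand has exactly the shifted factorials of \<open>X\<close>, hence is a multiple of
    \<open>X / D\<close>.\<close>
  define X :: rat where "X = pochhammer (- 1 / 3) (j + 1) * pochhammer (- 1 / 3) (j + 2 * s + 1)
     * pochhammer (- 1 / 3) (j + s + 1) / (fact j * fact (j + 2 * s) * fact (j + s))"
  define D :: rat where "D = (1 + of_nat j) * (1 + of_nat (j + 2 * s)) * (1 + of_nat (j + s))"
  define u v :: rat where "u = of_nat j" and "v = of_nat s"
  have E: "1 - 9 * v\<^sup>2 \<noteq> 0" using square_ne_ninth[of s] by (simp add: v_def)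
  have D: "D \<noteq> 0" unfolding D_def by (simp flip: of_nat_Suc del: of_nat_add)
  have D': "D = (1 + u) * (1 + u + 2 * v) * (1 + u + v)" by (simp add: D_def u_def v_def add.assoc)
  have summand: "(6 * of_nat (Suc j + s) - 1) * (pochhammer (- 1 / 3) (Suc j + s - s)
      * pochhammer (- 1 / 3) (Suc j + s + s) * pochhammer (- 1 / 3) (Suc j + s)) /
      (fact (Suc j + s - s) * fact (Suc j + s + s) * fact (Suc j + s)) =
      (6 * (u + v) + 5) * X / D"
  proof -
    have idx: "Suc j + s - s = Suc j" "Suc j + s + s = Suc (j + 2 * s)"
      by simp_all
    have lin: "6 * of_nat (Suc (j + s)) - 1 = 6 * (u + v) + 5"
      by (simp add: u_def v_def)
    show ?thesis
      unfolding idx unfolding add_Suc lin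
      unfolding fact_Suc X_def D_def Suc_eq_plus1[symmetric] of_nat_Suc
      by (simp only: times_divide_eq_left times_divide_eq_right divide_divide_eq_left mult_ac)
  qed
  have closed: "27 * (3 * of_nat (Suc j + s) + 1) / (1 - 9 * (of_nat s)\<^sup>2) *
     (pochhammer (- 1 / 3) (Suc j + 1) * pochhammer (- 1 / 3) (Suc j + 2 * s + 1)
        * pochhammer (- 1 / 3) (Suc j + s + 1)) /
     (fact (Suc j) * fact (Suc j + 2 * s) * fact (Suc j + s)) =
     27 * (3 * (u + v) + 4) / (1 - 9 * v\<^sup>2) *
       ((u + 2 / 3) * (u + 2 * v + 2 / 3) * (u + v + 2 / 3)) * X / D"
  proof -
    have P: "pochhammer (- 1 / 3 :: rat) (Suc (m + 1)) =
        pochhammer (- 1 / 3) (m + 1) * (of_nat m + 2 / 3)" for m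
      by (simp add: pochhammer_Suc[of _ "Suc m"])
    have lin: "3 * of_nat (Suc (j + s)) + 1 = 3 * (u + v) + 4"
      by (simp add: u_def v_def)
    show ?thesis
      unfolding add_Suc P lin
      unfolding fact_Suc X_def D_def of_nat_Suc
      unfolding of_nat_add of_nat_mult of_nat_numeral u_def[symmetric] v_def[symmetric]
      by (simp only: times_divide_eq_left times_divide_eq_right divide_divide_eq_left mult_ac)
  qed
  \<comment> \<open>The induction step with \<open>X / D\<close> removed and 1 - 9 v^2 cleared: a
    polynomial identity in \<open>u\<close> and \<open>v\<close>.\<close>
  have "27 * (3 * (u + v) + 1) * D + (6 * (u + v) + 5) * (1 - 9 * v\<^sup>2) =
     27 * (3 * (u + v) + 4) * ((u + 2 / 3) * (u + 2 * v + 2 / 3) * (u + v + 2 / 3))"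
    unfolding D' by (simp add: field_simps power2_eq_square)
  then have "27 * (3 * (u + v) + 1) / (1 - 9 * v\<^sup>2) + (6 * (u + v) + 5) / D =
     27 * (3 * (u + v) + 4) * ((u + 2 / 3) * (u + 2 * v + 2 / 3) * (u + v + 2 / 3)) /
       ((1 - 9 * v\<^sup>2) * D)"
    by (simp only: add_frac_eq[OF E D])
  from arg_cong[OF this, of "\<lambda>y. y * X"]
  have "(27 * (3 * (u + v) + 1) / (1 - 9 * v\<^sup>2)) * X + (6 * (u + v) + 5) * X / D =
     27 * (3 * (u + v) + 4) / (1 - 9 * v\<^sup>2) *
       ((u + 2 / 3) * (u + 2 * v + 2 / 3) * (u + v + 2 / 3)) * X / D"
    by (simp only: distrib_right times_divide_eq_left times_divide_eq_right divide_divide_eq_left)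
  moreover have "27 * (3 * of_nat (j + s) + 1) / (1 - 9 * (of_nat s)\<^sup>2) *
     (pochhammer (- 1 / 3) (j + 1) * pochhammer (- 1 / 3) (j + 2 * s + 1)
        * pochhammer (- 1 / 3) (j + s + 1)) /
     (fact j * fact (j + 2 * s) * fact (j + s)) = (27 * (3 * (u + v) + 1) / (1 - 9 * v\<^sup>2)) * X"
    by (simp add: X_def u_def v_def)
  moreover have "{s..Suc j + s} = insert (Suc j + s) {s..j + s}" by auto
  ultimately show ?case
    using Suc.IH summand closed by simp
qed

theorem corollary1p4:
  fixes p s :: nat
  assumes "prime p"
    and "[p = 1] (mod 3)"
    and "real s \<le> (real p - 4) / 6"
  shows "(\<Sum>k = s..(2 * p + 1) div 3 + s.
            (6 * of_nat k - 1) *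
            (pochhammer (- 1 / 3) (k - s) * pochhammer (- 1 / 3) (k + s) * pochhammer (- 1 / 3) k) /
            (fact (k - s) * fact (k + s) * fact k) :: rat) \<in> padic_multiples p 3"
proof -
  define n where "n = (2 * p + 1) div 3"
  define Q where "Q m = (\<Prod>j<m. 3 * int j - 1)" for m :: nat
  have P: "prime (int p)" using assms(1) by simp
  have "real (6 * s + 4) \<le> real p" using assms(3) by simp
  then have sp: "6 * s + 4 \<le> p" by (simp only: of_nat_le_iff)
  have "3 dvd 2 * p + 1"
    using assms(2) unfolding cong_def by presburger
  then have n: "3 * n = 2 * p + 1" by (simp add: n_def)
  \<comment> \<open>The factor with index j = n is 3 n - 1 = 2 p; it occurs as soon as m >
    n.\<close>
  have Q_dvd: "int p dvd Q m" if "m > n" for m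
  proof -
    have "3 * int n - 1 = 2 * int p" using n by linarith
    then have "int p dvd 3 * int n - 1" by simp
    also have "\<dots> dvd Q m"
      unfolding Q_def using that by (intro dvd_prodI) auto
    finally show ?thesis .
  qed
  obtain a b c where Qs: "Q (n + 1) = int p * a" "Q (n + 2 * s + 1) = int p * b"
    "Q (n + s + 1) = int p * c"
    using Q_dvd[of "n + 1"] Q_dvd[of "n + 2 * s + 1"] Q_dvd[of "n + s + 1"]
    by (auto simp: dvd_def)
  \<comment> \<open>All denominators of the closed form, with 1 - 9 s^2 split into linear factors so
    that each can be compared with \<open>p\<close>.\<close>
  define B where "B = (1 - 3 * int s) * (1 + 3 * int s) *
    (3 ^ (n + 1) * 3 ^ (n + 2 * s + 1) * 3 ^ (n + s + 1)) *
    (fact n * fact (n + 2 * s) * fact (n + s))"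
  have fact: "\<not> int p dvd fact m" if "m < p" for m
    using that assms(1) prime_dvd_fact_iff[of p m]
    by (metis int_dvd_int_iff not_le of_nat_fact)
  have three: "\<not> int p dvd 3 ^ m" for m
  proof
    assume "int p dvd 3 ^ m"
    then have "int p dvd 3" by (rule prime_dvd_power[OF P])
    then show False using sp zdvd_imp_le[of "int p" 3] by simp
  qed
  \<comment> \<open>Both factors are nonzero and smaller than \<open>p\<close> in absolute value.
    For s > 0 the first is negated to be positive; for s = 0 it is 1.\<close>
  have "\<not> int p dvd 1 - 3 * int s" "\<not> int p dvd 1 + 3 * int s"
  proof -
    show "\<not> int p dvd 1 + 3 * int s" using sp zdvd_imp_le by fastforce
    have "\<not> int p dvd 3 * int s - 1" if "s > 0"
      using sp that zdvd_imp_le by fastforce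
    moreover have "\<not> int p dvd 1" using P not_prime_unit by blast
    ultimately show "\<not> int p dvd 1 - 3 * int s"
      by (metis dvd_diff_commute gr0I diff_zero mult_zero_right of_nat_0)
  qed
  \<comment> \<open>The bound on \<open>s\<close> enters here: 3 (n + 2 s) = 2 p + 1 + 6 s \<le> 3 p
    - 3.\<close>
  moreover have "n + 2 * s < p" "n + s < p" "n < p" using n sp by linarith+
  ultimately have "\<not> int p dvd B"
    unfolding B_def prime_dvd_mult_iff[OF P] using fact three by blast
  moreover have "(27 * (3 * of_nat (n + s) + 1) / (1 - 9 * (of_nat s)\<^sup>2) *
     (pochhammer (- 1 / 3) (n + 1) * pochhammer (- 1 / 3) (n + 2 * s + 1)
        * pochhammer (- 1 / 3) (n + s + 1)) /
     (fact n * fact (n + 2 * s) * fact (n + s)) :: rat) =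
     of_int (int p ^ 3 * (27 * (3 * int (n + s) + 1) * (a * b * c))) / of_int B"
  proof -
    have E: "1 - 9 * (of_nat s :: rat)\<^sup>2 = (1 - 3 * of_nat s) * (1 + 3 * of_nat s)"
      by (simp add: algebra_simps power2_eq_square)
    show ?thesis
      unfolding pochhammer_minus_third Q_def[symmetric] Qs B_def E
      by (simp add: power3_eq_cube del: power_Suc power_add)
  qed
  ultimately show ?thesis
    unfolding n_def[symmetric] sum_very_well_poised_third
    using padic_multiplesI[OF assms(1)] by blast
qed

end
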